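(* Let $\Gamma$ be a finite, undirected, connected graph without loops or multiple edges, with vertex set $X$, and let $x\in X$. Let $T=T(x)$ be the subconstituent algebra and $Q=Q(x)\subseteq T$ the quantum adjacency algebra of $\Gamma$ with respect to $x$. Let $W$ be an irreducible $T$-module. Then the $Q$-module $W$ (obtained by restricting the $T$-action to $Q$) is irreducible.
   Context: $\mathrm{Mat}_X(\mathbb{C})$ is the $\mathbb{C}$-algebra of matrices with rows and columns indexed by $X$, acting by left multiplication on $V=\mathbb{C}^X$ (column vectors indexed by $X$). Subalgebras contain the identity $I$. Let $\partial$ be the path-length distance of $\Gamma$, $A\in\mathrm{Mat}_X(\mathbb{C})$ the adjacency matrix, and $D=\max\{\partial(x,y): y\in X\}$. For $0\le i\le D$, $E_i^*$ is the diagonal matrix with $(y,y)$-entry $1$ if $\partial(x,y)=i$ and $0$ otherwise. $T=T(x)$ is the subalgebra of $\mathrm{Mat}_X(\mathbb{C})$ generated by $A$ and $E_0^*,\dots,E_D^*$ (the subconstituent algebra). Put $L=\sum_{i=1}^{D}E_{i-1}^*AE_i^*$, $F=\sum_{i=0}^{D}E_i^*AE_i^*$, $R=\sum_{i=0}^{D-1}E_{i+1}^*AE_i^*$. $Q=Q(x)$ is the subalgebra of $T$ generated by $L,F,R$ (the quantum adjacency algebra). For a subalgebra $S$ of $\mathrm{Mat}_X(\mathbb{C})$, an $S$-module is a subspace $W\subseteq V$ with $SW\subseteq W$; it is irreducible if $W\ne 0$ and it contains no $S$-module other than $0$ and $W$. *)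

theory Defs
  imports "HOL-Analysis.Analysis"
begin

text \<open>
  A graph on the vertex set \<open>X = UNIV :: 'v set\<close>, \<open>'v\<close> finite, is given by its adjacency relation
  \<open>E :: 'v rel\<close>. Undirected and loopless mean \<^term>\<open>sym E\<close> and \<^term>\<open>irrefl E\<close>; multiple edges
  cannot occur. Matrices indexed by \<open>X\<close> have type \<^typ>\<open>complex^'v^'v\<close>, and the standard module
  is \<^typ>\<open>complex^'v\<close>; its complex subspaces are given by \<^const>\<open>vec.subspace\<close>, whereas the
  plain \<^const>\<open>subspace\<close> would only mean real subspaces.
\<close>

definition graph_connected :: "'v rel \<Rightarrow> bool" where
  "graph_connected E \<longleftrightarrow> (\<forall>u v. (u, v) \<in> E\<^sup>*)"

text \<open>\<open>(u, v) \<in> E ^^ n\<close> says that there is a walk of length \<open>n\<close> from \<open>u\<close> to \<open>v\<close>. In a connected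
  graph such an \<open>n\<close> always exists, and a shortest walk is a path.\<close>

definition gdist :: "'v rel \<Rightarrow> 'v \<Rightarrow> 'v \<Rightarrow> nat" where
  "gdist E u v = (LEAST n. (u, v) \<in> E ^^ n)"

definition ecc :: "'v::finite rel \<Rightarrow> 'v \<Rightarrow> nat" where
  "ecc E x = Max {gdist E x y | y. y \<in> UNIV}"

definition adj_mat :: "'v::finite rel \<Rightarrow> complex^'v^'v" where
  "adj_mat E = (\<chi> u v. if (u, v) \<in> E then 1 else 0)"

definition dual_idem :: "'v::finite rel \<Rightarrow> 'v \<Rightarrow> nat \<Rightarrow> complex^'v^'v" where
  "dual_idem E x i = (\<chi> u v. if u = v \<and> gdist E x u = i then 1 else 0)"

definition subalgebra :: "(complex^'v^'v) set \<Rightarrow> bool" where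
  "subalgebra S \<longleftrightarrow>
     mat 1 \<in> S \<and>
     (\<forall>M\<in>S. \<forall>N\<in>S. M + N \<in> S) \<and>
     (\<forall>c. \<forall>M\<in>S. (\<chi> u v. c * M $ u $ v) \<in> S) \<and>
     (\<forall>M\<in>S. \<forall>N\<in>S. M ** N \<in> S)"

definition subconstituent_algebra :: "'v::finite rel \<Rightarrow> 'v \<Rightarrow> (complex^'v^'v) set" where
  "subconstituent_algebra E x =
     subalgebra hull insert (adj_mat E) (dual_idem E x ` {0..ecc E x})"

definition lowering :: "'v::finite rel \<Rightarrow> 'v \<Rightarrow> complex^'v^'v" where
  "lowering E x = (\<Sum>i=1..ecc E x. dual_idem E x (i - 1) ** adj_mat E ** dual_idem E x i)"

definition flat :: "'v::finite rel \<Rightarrow> 'v \<Rightarrow> complex^'v^'v" where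
  "flat E x = (\<Sum>i=0..ecc E x. dual_idem E x i ** adj_mat E ** dual_idem E x i)"

text \<open>The range \<open>0 \<le> i \<le> D - 1\<close> is written \<open>0 \<le> i < D\<close>, so that the sum is empty for \<open>D = 0\<close>.\<close>

definition raising :: "'v::finite rel \<Rightarrow> 'v \<Rightarrow> complex^'v^'v" where
  "raising E x = (\<Sum>i=0..<ecc E x. dual_idem E x (i + 1) ** adj_mat E ** dual_idem E x i)"

definition quantum_adjacency_algebra :: "'v::finite rel \<Rightarrow> 'v \<Rightarrow> (complex^'v^'v) set" where
  "quantum_adjacency_algebra E x = subalgebra hull {lowering E x, flat E x, raising E x}"

definition is_module :: "(complex^'v^'v) set \<Rightarrow> (complex^'v) set \<Rightarrow> bool" where
  "is_module S W \<longleftrightarrow> vec.subspace W \<and> (\<forall>M\<in>S. \<forall>w\<in>W. M *v w \<in> W)"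

definition irreducible_module :: "(complex^'v^'v) set \<Rightarrow> (complex^'v) set \<Rightarrow> bool" where
  "irreducible_module S W \<longleftrightarrow>
     is_module S W \<and> W \<noteq> {0} \<and>
     (\<forall>U. is_module S U \<and> U \<subseteq> W \<longrightarrow> U = {0} \<or> U = W)"

lemma subalgebra_hull: "subalgebra (subalgebra hull G)"
  by (rule hull_in) (auto simp: subalgebra_def)

lemma subalgebra_sum:
  assumes "subalgebra S" and "\<And>i. i \<in> I \<Longrightarrow> f i \<in> S"
  shows "sum f I \<in> S"
proof -
  have "mat 1 \<in> S" using assms(1) by (simp add: subalgebra_def)
  then have "(\<chi> u v. 0 * (mat 1 :: complex^'a^'a) $ u $ v) \<in> S"
    using assms(1) unfolding subalgebra_def by blast
  then have z: "0 \<in> S" by (simp add: zero_vec_def)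
  show ?thesis
    using assms(2)
  proof (induction I rule: infinite_finite_induct)
    case (insert i I)
    then show ?case using assms(1) by (auto simp: subalgebra_def)
  qed (use z in auto)
qed

text \<open>Hence \<^const>\<open>quantum_adjacency_algebra\<close> is also the subalgebra of
  \<^const>\<open>subconstituent_algebra\<close> generated by the three matrices.\<close>

lemma quantum_adjacency_algebra_subset:
  "quantum_adjacency_algebra E x \<subseteq> subconstituent_algebra E x"
proof -
  let ?T = "subconstituent_algebra E x"
  have T: "subalgebra ?T"
    unfolding subconstituent_algebra_def by (rule subalgebra_hull)
  have gen: "insert (adj_mat E) (dual_idem E x ` {0..ecc E x}) \<subseteq> ?T"
    unfolding subconstituent_algebra_def by (rule hull_subset)
  have trip: "dual_idem E x i ** adj_mat E ** dual_idem E x j \<in> ?T"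
    if "i \<le> ecc E x" "j \<le> ecc E x" for i j
  proof -
    have "adj_mat E \<in> ?T" "dual_idem E x i \<in> ?T" "dual_idem E x j \<in> ?T"
      using gen that by auto
    then show ?thesis using T by (simp add: subalgebra_def)
  qed
  have "lowering E x \<in> ?T" "flat E x \<in> ?T" "raising E x \<in> ?T"
    unfolding lowering_def flat_def raising_def
    by (rule subalgebra_sum[OF T], rule trip, auto)+
  then show ?thesis
    unfolding quantum_adjacency_algebra_def by (intro hull_minimal) (use T in auto)
qed

end

theory Submission
  imports Defs
begin

text \<open>
  Let \<open>U \<subseteq> W\<close> be a \<open>Q\<close>-submodule; it has to be shown that \<open>U\<close> is stable under \<open>T\<close>, for then it
  is \<open>0\<close> or \<open>W\<close>. As \<open>L + F + R = A\<close>, only stability under the \<open>E\<^sub>i\<^sup>*\<close> is in question.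

  The set \<open>{L, F, R}\<close> is closed under adjoints, so the orthogonal complement of \<open>U\<close> is again
  stable under \<open>Q\<close>, and the orthogonal projection \<open>P\<close> onto \<open>U\<close> commutes with \<open>L\<close>, \<open>F\<close> and \<open>R\<close>.
  Grade the matrix algebra by letting the \<open>(u, v)\<close> matrix unit have degree
  \<open>\<partial>(x, u) - \<partial>(x, v)\<close>. Then \<open>L\<close>, \<open>F\<close>, \<open>R\<close> are homogeneous of degrees \<open>-1\<close>, \<open>0\<close>, \<open>1\<close>, so each
  homogeneous part \<open>P\<^sub>k\<close> of \<open>P\<close> commutes with them too. The kernel of \<open>P\<^sub>k\<close> in \<open>W\<close> is
  stable under \<open>L\<close>, \<open>F\<close>, \<open>R\<close> by commutation and under the \<open>E\<^sub>i\<^sup>*\<close> by homogeneity, so it is a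
  \<open>T\<close>-module. For \<open>k \<noteq> 0\<close> it is nonzero, because \<open>P\<^sub>k\<close> annihilates an extremal layer
  of \<open>W\<close>; by irreducibility it is all of \<open>W\<close>. Hence \<open>P\<close> agrees on \<open>W\<close> with \<open>P\<^sub>0\<close>, which commutes
  with every \<open>E\<^sub>i\<^sup>*\<close>, and so \<open>U = P W\<close> is stable under the \<open>E\<^sub>i\<^sup>*\<close>. The argument about \<open>P\<^sub>k\<close> is
  \<open>graded_part_kills_irreducible\<close>, and the projection comes from \<open>commuting_projection\<close>.
\<close>

section \<open>Modules over a generated algebra\<close>

lemma sum_matrix_vector_mult:
  "(\<Sum>i\<in>I. M i) *v (w :: complex^'n) = (\<Sum>i\<in>I. M i *v w)"
  by (induction I rule: infinite_finite_induct) (auto simp: matrix_vector_mult_add_rdistrib)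

lemma is_module_hull_iff:
  "is_module (subalgebra hull G) U \<longleftrightarrow> vec.subspace U \<and> (\<forall>M\<in>G. \<forall>w\<in>U. M *v w \<in> U)"
proof (intro iffI conjI)
  assume *: "vec.subspace U \<and> (\<forall>M\<in>G. \<forall>w\<in>U. M *v w \<in> U)"
  have scale: "(\<chi> u v. c * M $ u $ v) *v w = c *s (M *v w)"
    for c and M :: "complex^'a^'a" and w
    by (simp add: vec_eq_iff matrix_vector_mult_def sum_distrib_left mult.assoc)
  have "subalgebra {M. \<forall>w\<in>U. M *v w \<in> U}"
    using * unfolding subalgebra_def
    by (auto simp: scale matrix_vector_mult_add_rdistrib vec.subspace_add vec.subspace_scale
        simp flip: matrix_vector_mul_assoc)
  then have "subalgebra hull G \<subseteq> {M. \<forall>w\<in>U. M *v w \<in> U}"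
    using * by (intro hull_minimal) auto
  then show "is_module (subalgebra hull G) U"
    using * by (auto simp: is_module_def)
qed (auto simp: is_module_def intro: hull_inc)

section \<open>Orthogonal projections\<close>

lemma inner_mult_adjoint:
  fixes M M' :: "complex^'n^'n"
  assumes "\<And>i j. M' $ i $ j = cnj (M $ j $ i)"
  shows "(M *v u) \<bullet> v = u \<bullet> (M' *v v)"
proof -
  have complex: "a \<bullet> b = Re (a * cnj b)" for a b :: complex
    by (simp add: inner_complex_def)
  have "(M *v u) \<bullet> v = Re (\<Sum>i\<in>UNIV. \<Sum>j\<in>UNIV. M $ i $ j * u $ j * cnj (v $ i))"
    by (simp add: inner_vec_def matrix_vector_mult_def complex sum_distrib_right
        del: Re_sum times_complex.sel flip: Re_sum)
  also have "\<dots> = Re (\<Sum>j\<in>UNIV. \<Sum>i\<in>UNIV. M $ i $ j * u $ j * cnj (v $ i))"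
    by (subst sum.swap) (rule refl)
  also have "\<dots> = u \<bullet> (M' *v v)"
    by (simp add: inner_vec_def matrix_vector_mult_def complex sum_distrib_left assms mult_ac
        del: Re_sum times_complex.sel flip: Re_sum)
  finally show ?thesis .
qed

text \<open>The inner product on \<^typ>\<open>complex^'n\<close> is the real part of the Hermitian form. For a complex
  subspace it nevertheless yields the Hermitian complement, since multiplication by \<open>c\<close> is
  adjoint to multiplication by \<open>cnj c\<close>.\<close>

lemma inner_scale_cnj: "(u :: complex^'n) \<bullet> (c *s v) = (cnj c *s u) \<bullet> v"
  by (simp add: inner_vec_def inner_complex_def algebra_simps)

text \<open>If \<open>M\<close> and its adjoint \<open>M'\<close> both preserve \<open>U\<close>, then \<open>M\<close> also preserves the orthogonal
  complement of \<open>U\<close>, and hence commutes with the orthogonal projection onto \<open>U\<close>. The projection is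
  obtained on the whole space, so that it is a matrix whose entries can be graded.\<close>

lemma commuting_projection:
  fixes U :: "(complex^'n) set"
  assumes U: "vec.subspace U"
  obtains P where "\<And>v. P *v v \<in> U" and "\<And>u. u \<in> U \<Longrightarrow> P *v u = u"
    and "\<And>M M'. (\<And>i j. M' $ i $ j = cnj (M $ j $ i)) \<Longrightarrow> (\<And>u. u \<in> U \<Longrightarrow> M *v u \<in> U) \<Longrightarrow>
      (\<And>u. u \<in> U \<Longrightarrow> M' *v u \<in> U) \<Longrightarrow> P ** M = M ** P"
proof -
  define C where "C = {v. \<forall>u\<in>U. u \<bullet> v = 0}"
  have "subspace U"
  proof -
    have "c *\<^sub>R v = complex_of_real c *s v" for c and v :: "complex^'n"
      by (simp add: vec_eq_iff scaleR_conv_of_real[where 'a = complex])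
    then show ?thesis
      using U by (simp add: subspace_def vec.subspace_def)
  qed
  then have span: "span U = U"
    by (simp add: span_eq_iff)
  have C: "vec.subspace C"
    using U by (auto simp: vec.subspace_def C_def inner_add_right inner_scale_cnj)
  have "\<exists>y. y \<in> U \<and> v - y \<in> C" for v
  proof -
    obtain y z where "y \<in> span U" "\<And>w. w \<in> span U \<Longrightarrow> orthogonal z w" "v = y + z"
      using orthogonal_subspace_decomp_exists by blast
    then show ?thesis
      by (intro exI[of _ y]) (auto simp: C_def orthogonal_def inner_commute span)
  qed
  then obtain f where f: "\<And>v. f v \<in> U" "\<And>v. v - f v \<in> C"
    by metis
  have unique: "f v = y" if "y \<in> U" "v - y \<in> C" for v y
  proof -
    have "f v - y \<in> U"
      by (intro vec.subspace_diff U f that)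
    moreover have "(v - y) - (v - f v) \<in> C"
      by (intro vec.subspace_diff C f that)
    ultimately have "(f v - y) \<bullet> (f v - y) = 0"
      by (simp add: C_def)
    then show ?thesis by simp
  qed
  have "Vector_Spaces.linear (*s) (*s) f"
  proof
    fix v w c
    have "(v + w) - (f v + f w) \<in> C"
      unfolding add_diff_add by (intro vec.subspace_add C f)
    then show "f (v + w) = f v + f w"
      by (intro unique vec.subspace_add U f)
    have "c *s v - c *s f v \<in> C"
      using vec.subspace_scale[OF C f(2), of c v] by (simp add: vec.scale_right_diff_distrib)
    then show "f (c *s v) = c *s f v"
      by (intro unique vec.subspace_scale U f)
  qed
  then have P: "matrix f *v v = f v" for v
    by (rule matrix_works)
  show ?thesis
  proof (rule that[of "matrix f"])
    show "matrix f *v u = u" if "u \<in> U" for u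
      using that C by (auto simp: P intro!: unique vec.subspace_0)
  next
    fix M M'
    assume adj: "\<And>i j. M' $ i $ j = cnj (M $ j $ i)"
      and "\<And>u. u \<in> U \<Longrightarrow> M *v u \<in> U" "\<And>u. u \<in> U \<Longrightarrow> M' *v u \<in> U"
    have "M *v v \<in> C" if "v \<in> C" for v
    proof -
      have "u \<bullet> (M *v v) = (M' *v u) \<bullet> v" for u
        by (subst inner_mult_adjoint[of M M']) (simp_all add: adj)
      then show ?thesis
        using that \<open>\<And>u. u \<in> U \<Longrightarrow> M' *v u \<in> U\<close> by (simp add: C_def)
    qed
    then have "M *v v - M *v f v \<in> C" for v
      using f(2) by (metis matrix_vector_mult_diff_distrib)
    then have "f (M *v v) = M *v f v" for v
      using f(1) \<open>\<And>u. u \<in> U \<Longrightarrow> M *v u \<in> U\<close> by (intro unique) auto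
    then show "matrix f ** M = M ** matrix f"
      by (simp add: matrix_eq P flip: matrix_vector_mul_assoc)
  qed (simp add: P f)
qed

section \<open>The grading of the matrix algebra\<close>

definition graded_part :: "('n \<Rightarrow> nat) \<Rightarrow> int \<Rightarrow> complex^'n^'n \<Rightarrow> complex^'n^'n" where
  "graded_part d k M = (\<chi> u v. if int (d u) - int (d v) = k then M $ u $ v else 0)"

lemma graded_part_mult_right:
  "graded_part d k M ** graded_part d m N = graded_part d (k + m) (M ** graded_part d m N)"
  by (auto simp: vec_eq_iff graded_part_def matrix_matrix_mult_def intro!: sum.cong sum.neutral)

lemma graded_part_mult_left:
  "graded_part d m N ** graded_part d k M = graded_part d (k + m) (graded_part d m N ** M)"
  by (auto simp: vec_eq_iff graded_part_def matrix_matrix_mult_def intro!: sum.cong sum.neutral)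

text \<open>For homogeneous \<open>N\<close> of degree \<open>m\<close>, both products are the parts of degree \<open>k + m\<close> of \<open>P N\<close>
  and \<open>N P\<close>.\<close>

lemma graded_part_commute:
  assumes "P ** graded_part d m N = graded_part d m N ** P"
  shows "graded_part d k P ** graded_part d m N = graded_part d m N ** graded_part d k P"
  by (simp only: graded_part_mult_right[of d k P m N] graded_part_mult_left[of d m N k P] assms)

lemma sum_graded_part:
  fixes M :: "complex^'n^'n"
  assumes "\<And>u. d u \<le> D"
  shows "(\<Sum>k\<in>{- int D..int D}. graded_part d k M) = M"
proof -
  have "int (d u) - int (d v) \<in> {- int D..int D}" for u v
    using assms[of u] assms[of v] by auto
  then show ?thesis
    by (simp add: vec_eq_iff graded_part_def)
qed

lemma dual_idem_mult_vec:
  "dual_idem E x i *v w = (\<chi> u. if gdist E x u = i then w $ u else 0)"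
  by (auto simp: vec_eq_iff dual_idem_def matrix_vector_mult_def if_distrib[of "\<lambda>a. a * _"]
      cong: if_cong conj_cong intro: sum.neutral)

lemma dual_idem_triple:
  "(dual_idem E x i ** M ** dual_idem E x j) $ u $ v =
    (if gdist E x u = i \<and> gdist E x v = j then M $ u $ v else 0)"
proof -
  have "(dual_idem E x i ** M) $ u $ w = (if gdist E x u = i then M $ u $ w else 0)" for w
    by (auto simp: dual_idem_def matrix_matrix_mult_def if_distrib[of "\<lambda>a. a * _"]
        cong: if_cong conj_cong intro: sum.neutral)
  then show ?thesis
    unfolding matrix_matrix_mult_def[of "dual_idem E x i ** M"]
    by (simp add: dual_idem_def if_distrib[of "\<lambda>a. _ * a"] cong: if_cong conj_cong)
qed

lemma gdist_le_ecc: "gdist E x u \<le> ecc E x"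
  unfolding ecc_def by (rule Max_ge) (auto simp: full_SetCompr_eq)

lemma gdist_step:
  assumes "graph_connected E" "(u, v) \<in> E"
  shows "gdist E x v \<le> Suc (gdist E x u)"
proof -
  obtain n where "(x, u) \<in> E ^^ n"
    using assms(1) by (meson graph_connected_def rtrancl_imp_relpow)
  then have "(x, u) \<in> E ^^ gdist E x u"
    unfolding gdist_def by (rule LeastI)
  then have "(x, v) \<in> E ^^ Suc (gdist E x u)"
    using assms(2) by auto
  then show ?thesis
    unfolding gdist_def[of E x v] by (rule Least_le)
qed

lemma lowering_eq_graded_part: "lowering E x = graded_part (gdist E x) (-1) (adj_mat E)"
proof -
  have "(\<Sum>i=1..ecc E x. if gdist E x u = i - 1 \<and> gdist E x v = i then a else 0) =
      (if int (gdist E x u) - int (gdist E x v) = -1 then a else 0)" for u v and a :: complex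
  proof -
    have "(\<Sum>i=1..ecc E x. if gdist E x u = i - 1 \<and> gdist E x v = i then a else 0) =
      (\<Sum>i=1..ecc E x. if i = gdist E x v then
        if int (gdist E x u) - int (gdist E x v) = -1 then a else 0 else 0)"
      by (rule sum.cong) auto
    then show ?thesis
      using gdist_le_ecc[of E x v] by auto
  qed
  then show ?thesis
    by (simp add: vec_eq_iff lowering_def dual_idem_triple graded_part_def)
qed

lemma flat_eq_graded_part: "flat E x = graded_part (gdist E x) 0 (adj_mat E)"
proof -
  have "(\<Sum>i=0..ecc E x. if gdist E x u = i \<and> gdist E x v = i then a else 0) =
      (if int (gdist E x u) - int (gdist E x v) = 0 then a else 0)" for u v and a :: complex
  proof -
    have "(\<Sum>i=0..ecc E x. if gdist E x u = i \<and> gdist E x v = i then a else 0) =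
      (\<Sum>i=0..ecc E x. if i = gdist E x v then
        if int (gdist E x u) - int (gdist E x v) = 0 then a else 0 else 0)"
      by (rule sum.cong) auto
    then show ?thesis
      using gdist_le_ecc[of E x v] by auto
  qed
  then show ?thesis
    by (simp add: vec_eq_iff flat_def dual_idem_triple graded_part_def)
qed

lemma raising_eq_graded_part: "raising E x = graded_part (gdist E x) 1 (adj_mat E)"
proof -
  have "(\<Sum>i=0..<ecc E x. if gdist E x u = i + 1 \<and> gdist E x v = i then a else 0) =
      (if int (gdist E x u) - int (gdist E x v) = 1 then a else 0)" for u v and a :: complex
  proof -
    have "(\<Sum>i=0..<ecc E x. if gdist E x u = i + 1 \<and> gdist E x v = i then a else 0) =
      (\<Sum>i=0..<ecc E x. if i = gdist E x v then
        if int (gdist E x u) - int (gdist E x v) = 1 then a else 0 else 0)"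
      by (rule sum.cong) auto
    then show ?thesis
      using gdist_le_ecc[of E x u] by auto
  qed
  then show ?thesis
    by (simp add: vec_eq_iff raising_def dual_idem_triple graded_part_def)
qed

text \<open>Adjacent vertices have distances from \<open>x\<close> that differ by at most one, so the adjacency matrix
  has no parts of other degrees.\<close>

lemma adj_mat_decomp:
  assumes "sym E" "graph_connected E"
  shows "adj_mat E = lowering E x + flat E x + raising E x"
proof -
  have "int (gdist E x u) - int (gdist E x v) \<in> {-1, 0, 1}" if "(u, v) \<in> E" for u v
    using gdist_step[OF assms(2) that, of x] gdist_step[OF assms(2) symD[OF assms(1) that], of x]
    by auto
  then show ?thesis
    unfolding lowering_eq_graded_part flat_eq_graded_part raising_eq_graded_part
    by (fastforce simp: vec_eq_iff graded_part_def adj_mat_def)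
qed

section \<open>Submodules of an irreducible module\<close>

text \<open>This is \<open>P\<^sub>k E\<^sub>i\<^sup>* = E\<^sub>i\<^sub>+\<^sub>k\<^sup>* P\<^sub>k\<close>, in coordinates because \<open>i + k\<close> may be negative.\<close>

lemma graded_part_dual_idem:
  "(graded_part (gdist E x) k P *v (dual_idem E x i *v w)) $ u =
    (if int (gdist E x u) = int i + k then (graded_part (gdist E x) k P *v w) $ u else 0)"
proof -
  have "(graded_part (gdist E x) k P *v y) $ u =
      (\<Sum>v\<in>UNIV. (if int (gdist E x u) - int (gdist E x v) = k then P $ u $ v else 0) * y $ v)"
    for y
    by (simp add: matrix_vector_mult_def graded_part_def)
  then show ?thesis
    by (auto simp: dual_idem_mult_vec intro!: sum.cong sum.neutral)
qed

text \<open>\<open>P\<^sub>k\<close> is the sum of the blocks \<open>E\<^sub>i\<^sup>* P E\<^sub>j\<^sup>*\<close> with \<open>i - j = k\<close>, and each factor preserves \<open>W\<close>.\<close>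

lemma graded_part_preserves:
  fixes W :: "(complex^'v::finite) set"
  assumes W: "is_module (subconstituent_algebra E x) W"
    and P: "\<And>w. w \<in> W \<Longrightarrow> P *v w \<in> W" and "w \<in> W"
  shows "graded_part (gdist E x) k P *v w \<in> W"
proof -
  let ?I = "{(i, j). i \<le> ecc E x \<and> j \<le> ecc E x \<and> int i - int j = k}"
  have sub: "vec.subspace W"
    and dual: "\<And>i w. i \<le> ecc E x \<Longrightarrow> w \<in> W \<Longrightarrow> dual_idem E x i *v w \<in> W"
    using W unfolding subconstituent_algebra_def is_module_hull_iff by auto
  have fin: "finite ?I"
    by (rule finite_subset[of _ "{..ecc E x} \<times> {..ecc E x}"]) auto
  have "graded_part (gdist E x) k P = (\<Sum>(i, j)\<in>?I. dual_idem E x i ** P ** dual_idem E x j)"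
  proof -
    have "(\<Sum>p\<in>?I. if gdist E x u = fst p \<and> gdist E x v = snd p then a else 0) =
        (if int (gdist E x u) - int (gdist E x v) = k then a else 0)" for u v and a :: complex
    proof -
      have "(\<Sum>p\<in>?I. if gdist E x u = fst p \<and> gdist E x v = snd p then a else 0) =
          (\<Sum>p\<in>?I. if p = (gdist E x u, gdist E x v) then a else 0)"
        by (rule sum.cong) auto
      then show ?thesis
        using fin by (simp add: gdist_le_ecc)
    qed
    then show ?thesis
      by (simp add: vec_eq_iff graded_part_def dual_idem_triple case_prod_beta)
  qed
  then have "graded_part (gdist E x) k P *v w =
      (\<Sum>(i, j)\<in>?I. dual_idem E x i *v (P *v (dual_idem E x j *v w)))"
    by (simp add: sum_matrix_vector_mult case_prod_beta matrix_vector_mul_assoc matrix_mul_assoc)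
  also have "\<dots> \<in> W"
    using \<open>w \<in> W\<close> by (auto intro!: vec.subspace_sum[OF sub] dual P)
  finally show ?thesis .
qed

text \<open>The kernel of the graded part in \<open>W\<close> is a \<open>T\<close>-module, and it contains the last layer
  \<open>E\<^sub>i\<^sup>* W \<noteq> 0\<close> in the direction of \<open>k\<close>, since the layer \<open>E\<^sub>i\<^sub>+\<^sub>k\<^sup>* W\<close> vanishes.\<close>

lemma graded_part_kills_irreducible:
  fixes E :: "'v::finite rel"
  assumes E: "sym E" "graph_connected E"
    and irr: "irreducible_module (subconstituent_algebra E x) W"
    and P: "\<And>w. w \<in> W \<Longrightarrow> P *v w \<in> W"
    and comm: "\<And>M. M \<in> {lowering E x, flat E x, raising E x} \<Longrightarrow> P ** M = M ** P"
    and "k \<noteq> 0" "w \<in> W"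
  shows "graded_part (gdist E x) k P *v w = 0"
proof -
  let ?d = "gdist E x" and ?Pk = "graded_part (gdist E x) k P"
  have W: "is_module (subconstituent_algebra E x) W"
    using irr by (simp add: irreducible_module_def)
  then have sub: "vec.subspace W"
    and adj: "\<And>w. w \<in> W \<Longrightarrow> adj_mat E *v w \<in> W"
    and dual: "\<And>i w. i \<le> ecc E x \<Longrightarrow> w \<in> W \<Longrightarrow> dual_idem E x i *v w \<in> W"
    unfolding subconstituent_algebra_def is_module_hull_iff by auto
  define K where "K = {w \<in> W. ?Pk *v w = 0}"
  have "?Pk ** M = M ** ?Pk" if "M \<in> {lowering E x, flat E x, raising E x}" for M
    using comm that
    by (auto simp: lowering_eq_graded_part flat_eq_graded_part raising_eq_graded_part
        intro!: graded_part_commute)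
  then have "?Pk *v (M *v w) = M *v (?Pk *v w)" 
    if "M \<in> {lowering E x, flat E x, raising E x}" for M w
    using that by (simp add: matrix_vector_mul_assoc)
  then have adj_comm: "?Pk *v (adj_mat E *v w) = adj_mat E *v (?Pk *v w)" for w
    by (simp add: adj_mat_decomp[OF E, of x] matrix_vector_mult_add_rdistrib
        matrix_vector_right_distrib)
  have "is_module (subconstituent_algebra E x) K"
    unfolding subconstituent_algebra_def is_module_hull_iff
  proof (intro conjI ballI)
    show "vec.subspace K"
      using sub by (auto simp: K_def vec.subspace_def matrix_vector_right_distrib vec.scale)
  next
    fix M w assume "M \<in> insert (adj_mat E) (dual_idem E x ` {0..ecc E x})" "w \<in> K"
    then consider "M = adj_mat E" | i where "M = dual_idem E x i" "i \<le> ecc E x"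
      by auto
    then show "M *v w \<in> K"
    proof cases
      case 1
      then show ?thesis
        using \<open>w \<in> K\<close> adj by (simp add: K_def adj_comm)
    next
      case 2
      have "?Pk *v (dual_idem E x i *v w) = 0"
        using \<open>w \<in> K\<close> by (simp add: vec_eq_iff graded_part_dual_idem K_def)
      then show ?thesis
        using 2 \<open>w \<in> K\<close> dual by (simp add: K_def)
    qed
  qed
  moreover have "K \<noteq> {0}"
  proof -
    define S where "S = {u. \<exists>w\<in>W. w $ u \<noteq> 0}"
    have "W \<noteq> {0}"
      using irr by (simp add: irreducible_module_def)
    then obtain w0 where "w0 \<in> W" "w0 \<noteq> 0"
      using vec.subspace_0[OF sub] by blast
    then have "S \<noteq> {}"
      by (auto simp: S_def vec_eq_iff)
    \<comment> \<open>Multiplying the distance by \<open>k\<close> selects the outermost layer if \<open>k > 0\<close> and the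
      innermost one if \<open>k < 0\<close>.\<close>
    then have "Max ((\<lambda>u. k * int (?d u)) ` S) \<in> (\<lambda>u. k * int (?d u)) ` S"
      by (intro Max_in) auto
    then obtain u where u: "u \<in> S" "Max ((\<lambda>u. k * int (?d u)) ` S) = k * int (?d u)"
      by auto
    have max: "k * int (?d v) \<le> k * int (?d u)" if "v \<in> S" for v
      using that by (auto simp flip: u(2) intro: Max_ge)
    obtain w where w: "w \<in> W" "w $ u \<noteq> 0"
      using u(1) by (auto simp: S_def)
    let ?w = "dual_idem E x (?d u) *v w"
    have "?w \<in> W"
      using w dual gdist_le_ecc by blast
    have "?w $ u \<noteq> 0"
      using w by (simp add: dual_idem_mult_vec)
    then have "?w \<noteq> 0" by auto
    have "(?Pk *v ?w) $ v = 0" for v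
    proof (rule ccontr)
      assume "(?Pk *v ?w) $ v \<noteq> 0"
      moreover have "?Pk *v ?w \<in> W"
        using W P \<open>?w \<in> W\<close> by (rule graded_part_preserves)
      ultimately have "v \<in> S"
        unfolding S_def by blast
      have "int (?d v) = int (?d u) + k"
        using \<open>(?Pk *v ?w) $ v \<noteq> 0\<close> by (simp add: graded_part_dual_idem split: if_splits)
      then have "k * k \<le> 0"
        using max[OF \<open>v \<in> S\<close>] by (simp add: algebra_simps)
      then show False
        using \<open>k \<noteq> 0\<close> by (metis mult_eq_0_iff order_antisym zero_le_square)
    qed
    then have "?w \<in> K"
      using \<open>?w \<in> W\<close> by (simp add: K_def vec_eq_iff)
    then show ?thesis
      using \<open>?w \<noteq> 0\<close> by blast
  qed
  ultimately have "K = W"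
    using irr unfolding irreducible_module_def by (auto simp: K_def)
  then show ?thesis
    using \<open>w \<in> W\<close> by (auto simp: K_def)
qed

theorem proposition6p3:
  fixes E :: "'v::finite rel" and x :: 'v and W :: "(complex^'v) set"
  assumes "sym E" and "irrefl E" and "graph_connected E"
    and "irreducible_module (subconstituent_algebra E x) W"
  shows "irreducible_module (quantum_adjacency_algebra E x) W"
  unfolding irreducible_module_def
proof (intro conjI allI impI)
  let ?d = "gdist E x" and ?G = "{lowering E x, flat E x, raising E x}"
  have W: "is_module (subconstituent_algebra E x) W"
    using assms(4) by (simp add: irreducible_module_def)
  show "W \<noteq> {0}"
    using assms(4) by (simp add: irreducible_module_def)
  show "is_module (quantum_adjacency_algebra E x) W"
    using W quantum_adjacency_algebra_subset[of E x] by (auto simp: is_module_def)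
  fix U assume "is_module (quantum_adjacency_algebra E x) U \<and> U \<subseteq> W"
  then have sub: "vec.subspace U" and stable: "\<And>M u. M \<in> ?G \<Longrightarrow> u \<in> U \<Longrightarrow> M *v u \<in> U"
    and "U \<subseteq> W"
    unfolding quantum_adjacency_algebra_def is_module_hull_iff by auto
  obtain P where P: "\<And>v. P *v v \<in> U" "\<And>u. u \<in> U \<Longrightarrow> P *v u = u"
    and comm: "\<And>M M'. (\<And>i j. M' $ i $ j = cnj (M $ j $ i)) \<Longrightarrow>
      (\<And>u. u \<in> U \<Longrightarrow> M *v u \<in> U) \<Longrightarrow> (\<And>u. u \<in> U \<Longrightarrow> M' *v u \<in> U) \<Longrightarrow> P ** M = M ** P"
    using commuting_projection[OF sub] by blast
  have edge: "(u, v) \<in> E \<longleftrightarrow> (v, u) \<in> E" for u v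
    using assms(1) by (auto dest: symD)
  have adjoint: "raising E x $ i $ j = cnj (lowering E x $ j $ i)"
    "lowering E x $ i $ j = cnj (raising E x $ j $ i)"
    "flat E x $ i $ j = cnj (flat E x $ j $ i)" for i j
    using edge[of i j]
    by (auto simp: lowering_eq_graded_part flat_eq_graded_part raising_eq_graded_part
        graded_part_def adj_mat_def)
  have P_comm: "P ** M = M ** P" if "M \<in> ?G" for M
    using that comm[OF adjoint(1)] comm[OF adjoint(2)] comm[OF adjoint(3)] stable by blast
  have P_eq: "P *v w = graded_part ?d 0 P *v w" if "w \<in> W" for w
  proof -
    let ?J = "{- int (ecc E x)..int (ecc E x)}"
    have "P *v w = (\<Sum>k\<in>?J. graded_part ?d k P) *v w"
      by (subst sum_graded_part) (auto intro: gdist_le_ecc)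
    also have "\<dots> = (\<Sum>k\<in>?J. graded_part ?d k P *v w)"
      by (simp add: sum_matrix_vector_mult)
    also have "\<dots> = (\<Sum>k\<in>{0}. graded_part ?d k P *v w)"
      using graded_part_kills_irreducible[OF assms(1,3,4) _ P_comm _ that] P(1) \<open>U \<subseteq> W\<close>
      by (intro sum.mono_neutral_right) auto
    finally show ?thesis by simp
  qed
  have "dual_idem E x i *v u \<in> U" if "u \<in> U" "i \<le> ecc E x" for i u
  proof -
    have "dual_idem E x i *v u \<in> W"
      using W that \<open>U \<subseteq> W\<close> unfolding subconstituent_algebra_def is_module_hull_iff by auto
    then have "P *v (dual_idem E x i *v u) = graded_part ?d 0 P *v (dual_idem E x i *v u)"
      by (rule P_eq)
    also have "\<dots> = dual_idem E x i *v (graded_part ?d 0 P *v u)"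
      by (simp add: vec_eq_iff graded_part_dual_idem) (simp add: dual_idem_mult_vec)
    also have "\<dots> = dual_idem E x i *v u"
      using that \<open>U \<subseteq> W\<close> P(2) P_eq by (metis subsetD)
    finally show ?thesis
      using P(1) by metis
  qed
  moreover have "adj_mat E *v u \<in> U" if "u \<in> U" for u
    using that stable sub
    by (simp add: adj_mat_decomp[OF assms(1,3), of x] matrix_vector_mult_add_rdistrib
        vec.subspace_add)
  ultimately have "is_module (subconstituent_algebra E x) U"
    unfolding subconstituent_algebra_def is_module_hull_iff using sub by auto
  then show "U = {0} \<or> U = W"
    using assms(4) \<open>U \<subseteq> W\<close> by (simp add: irreducible_module_def)
qed

end
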